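(* There exists a homogeneous set $X\subseteq\mathbb{R}^{2}$ and a $C^{\infty}$ map $f:\mathbb{R}^{2}\to\mathbb{R}$ which is injective on $X$ (so each fiber $X\cap f^{-1}(y)$, $y\in f(X)$, is a singleton) and such that $\dim f(X)<\dim X$.
   Context: $\dim$ denotes Hausdorff dimension of sets. $\mathbb{R}^d$ carries the sup-norm and $B_1=[-1,1]^d$. For a ball $E=B_r(x)$, $T_E(y)=\frac1r(y-x)$ is the homothety mapping $E$ onto $B_1$. For a compact set $X\subseteq\mathbb{R}^d$, a miniset of $X$ is a non-empty set of the form $B_1\cap T_EX$ with $E$ a ball; a microset of $X$ is a limit of minisets of $X$ in the Hausdorff metric on the space of closed subsets of $B_1$. A compact set $X$ is homogeneous if every microset of $X$ is a subset of some miniset of $X$. *)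

theory Defs
  imports "HOL-Analysis.Analysis"
begin

text \<open>
  All metric notions below refer to the sup-norm \<^const>\<open>infnorm\<close>, not to the Euclidean
  \<^const>\<open>dist\<close> that the type class provides. On \<^typ>\<open>real\<close> the two coincide.
\<close>

section \<open>Hausdorff dimension\<close>

definition sup_diam :: "'a::euclidean_space set \<Rightarrow> ennreal" where
  "sup_diam U = (SUP x\<in>U. SUP y\<in>U. ennreal (infnorm (x - y)))"

text \<open>
  Countable covers are sequences; finite covers are padded with empty sets, which have
  diameter \<open>0\<close> and contribute \<open>0 powr s = 0\<close>. The bound on the diameters makes
  \<^const>\<open>enn2real\<close> exact here.
\<close>

definition hausdorff_premeasure :: "real \<Rightarrow> real \<Rightarrow> 'a::euclidean_space set \<Rightarrow> ennreal" where
  "hausdorff_premeasure s \<delta> X =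
     (INF U \<in> {U :: nat \<Rightarrow> 'a set. X \<subseteq> (\<Union>i. U i) \<and> (\<forall>i. sup_diam (U i) \<le> ennreal \<delta>)}.
        \<Sum>i. ennreal (enn2real (sup_diam (U i)) powr s))"

definition hausdorff_measure :: "real \<Rightarrow> 'a::euclidean_space set \<Rightarrow> ennreal" where
  "hausdorff_measure s X = (SUP \<delta>\<in>{0<..}. hausdorff_premeasure s \<delta> X)"

text \<open>
  Only \<open>s > 0\<close> is used, because \<open>0 powr 0 = 0\<close> would spoil the counting measure at \<open>s = 0\<close>;
  this does not affect the infimum.
\<close>

definition hausdorff_dim :: "'a::euclidean_space set \<Rightarrow> ennreal" where
  "hausdorff_dim X = (INF s\<in>{s. 0 < s \<and> hausdorff_measure s X = 0}. ennreal s)"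

section \<open>Minisets, microsets and homogeneous sets\<close>

definition unit_cube :: "'a::euclidean_space set" where
  "unit_cube = cbox (- One) One"

definition homothety :: "'a::euclidean_space \<Rightarrow> real \<Rightarrow> 'a \<Rightarrow> 'a" where
  "homothety x r y = (1 / r) *\<^sub>R (y - x)"

definition miniset :: "'a::euclidean_space set \<Rightarrow> 'a set \<Rightarrow> bool" where
  "miniset X M \<longleftrightarrow> M \<noteq> {} \<and> (\<exists>x r. r > 0 \<and> M = unit_cube \<inter> homothety x r ` X)"

text \<open>
  With values in \<^typ>\<open>ennreal\<close> the distance between the empty set and a non-empty set is infinite,
  so the empty set is an isolated point.
\<close>

definition hausdorff_distance :: "'a::euclidean_space set \<Rightarrow> 'a set \<Rightarrow> ennreal" where
  "hausdorff_distance A B =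
     max (SUP a\<in>A. INF b\<in>B. ennreal (infnorm (a - b)))
         (SUP b\<in>B. INF a\<in>A. ennreal (infnorm (a - b)))"

definition microset :: "'a::euclidean_space set \<Rightarrow> 'a set \<Rightarrow> bool" where
  "microset X K \<longleftrightarrow> closed K \<and> K \<subseteq> unit_cube \<and>
     (\<exists>M :: nat \<Rightarrow> 'a set. (\<forall>n. miniset X (M n)) \<and> (\<lambda>n. hausdorff_distance (M n) K) \<longlonglongrightarrow> 0)"

definition homogeneous :: "'a::euclidean_space set \<Rightarrow> bool" where
  "homogeneous X \<longleftrightarrow> compact X \<and> (\<forall>K. microset X K \<longrightarrow> (\<exists>M. miniset X M \<and> K \<subseteq> M))"

section \<open>Smooth maps\<close>

text \<open>
  \<open>C_diff k f\<close>: \<open>f\<close> is of class \<open>C\<^sup>k\<close> on the whole space, by recursion through all directional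
  derivatives.
\<close>

primrec C_diff :: "nat \<Rightarrow> ('a::euclidean_space \<Rightarrow> 'b::real_normed_vector) \<Rightarrow> bool" where
  "C_diff 0 f \<longleftrightarrow> continuous_on UNIV f"
| "C_diff (Suc k) f \<longleftrightarrow>
     (\<forall>x. f differentiable (at x)) \<and> (\<forall>v. C_diff k (\<lambda>x. frechet_derivative f (at x) v))"

definition smooth :: "('a::euclidean_space \<Rightarrow> 'b::real_normed_vector) \<Rightarrow> bool" where
  "smooth f \<longleftrightarrow> (\<forall>k. C_diff k f)"

end

theory Submission
  imports Defs
begin

text \<open>
  Take the Cantor set \<open>C\<close> of base-4 digits 0 and 3, of dimension 1/2, placed on a line in the plane. A ball
  of radius below 1/4 meets only one of the two halves of \<open>C\<close>, so small minisets are also minisets at a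
  bounded scale, and compactness gives homogeneity. Choose a smooth \<open>h \<ge> 0\<close> that vanishes on \<open>C\<close> and is
  positive on a dense set, and let \<open>g' = h\<close>. Then \<open>g\<close> is strictly increasing, hence injective; but as \<open>h\<close>
  is Lipschitz on \<open>[0, 1]\<close>, it is \<open>O(4\<^sup>-\<^sup>n)\<close> on the \<open>2\<^sup>n\<close> intervals of level \<open>n\<close>, which \<open>g\<close> therefore maps to
  intervals of length \<open>O(16\<^sup>-\<^sup>n)\<close>. So \<open>g(C)\<close> has dimension at most 1/4 (3/8 suffices), and \<open>f(x, y) = g(x)\<close>
  is the required map.
\<close>

section \<open>Bounds on Hausdorff dimension\<close>

lemma infnorm_le_sup_diam:
  assumes "x \<in> U" "y \<in> U"
  shows "ennreal (infnorm (x - y)) \<le> sup_diam U"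
  unfolding sup_diam_def using assms by (meson SUP_upper2 order_refl)

text \<open>A mass distribution argument: for a cover of \<open>X\<close>, the parameters landing in
  \<open>U i\<close> lie in an interval of length proportional to a power of the diameter, and
  together these intervals must cover length 1. So no exponent \<open>t\<close> below
  \<open>s\<close> gives measure zero.\<close>

lemma hausdorff_dim_ge:
  fixes p :: "real \<Rightarrow> 'a::euclidean_space"
  assumes p: "p ` {0..<1} \<subseteq> X"
    and expand: "\<And>y z. y \<in> {0..<1} \<Longrightarrow> z \<in> {0..<1} \<Longrightarrow> \<bar>y - z\<bar> \<le> c * infnorm (p y - p z) powr s"
    and "0 < c"
  shows "ennreal s \<le> hausdorff_dim X"
  unfolding hausdorff_dim_def
proof (rule INF_greatest, rule ennreal_leI, rule ccontr)
  fix t assume "t \<in> {t. 0 < t \<and> hausdorff_measure t X = 0}" and "\<not> s \<le> t"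
  then have t: "0 < t" "hausdorff_measure t X = 0" "t \<le> s" by auto
  have "hausdorff_premeasure t 1 X \<le> hausdorff_measure t X"
    unfolding hausdorff_measure_def by (rule SUP_upper) auto
  \<comment> \<open>With this bound the intervals \<open>J i\<close> below, of length
    \<open>2 * l i\<close>, have total length less than 1.\<close>
  also have "\<dots> < ennreal (1 / (2 * c))"
    using t \<open>0 < c\<close> by simp
  finally obtain U where U: "X \<subseteq> (\<Union>i. U i)" "\<And>i. sup_diam (U i) \<le> ennreal 1"
    and small: "(\<Sum>i. ennreal (enn2real (sup_diam (U i)) powr t)) < ennreal (1 / (2 * c))"
    unfolding hausdorff_premeasure_def INF_less_iff by auto
  define l where "l = (\<lambda>i. c * enn2real (sup_diam (U i)) powr t)"
  have l: "\<bar>y - z\<bar> \<le> l i" if "y \<in> {0..<1}" "z \<in> {0..<1}" "p y \<in> U i" "p z \<in> U i" for y z i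
  proof -
    have "ennreal (infnorm (p y - p z)) \<le> sup_diam (U i)"
      using that by (intro infnorm_le_sup_diam)
    then have "infnorm (p y - p z) \<le> enn2real (sup_diam (U i))"
      using enn2real_mono[of _ "sup_diam (U i)"] U(2)[of i] infnorm_pos_le
      by (metis enn2real_ennreal ennreal_less_top order_le_less_trans)
    \<comment> \<open>Diameters at most 1 are what makes lowering the exponent from \<open>s\<close>
      to \<open>t\<close> enlarge the power.\<close>
    moreover have "enn2real (sup_diam (U i)) \<le> 1"
      using U(2)[of i] enn2real_leI by fastforce
    ultimately have "infnorm (p y - p z) powr s \<le> enn2real (sup_diam (U i)) powr t"
      using t infnorm_pos_le[of "p y - p z"]
      by (meson enn2real_nonneg order_trans powr_mono' powr_mono2 less_imp_le)
    then show ?thesis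
      using expand[OF that(1,2)] \<open>0 < c\<close> unfolding l_def
      by (meson mult_left_mono less_imp_le order_trans)
  qed
  \<comment> \<open>If no parameter lands in \<open>U i\<close>, then \<open>y i\<close> is
    arbitrary and \<open>J i\<close> is a harmless extra interval, already paid for in the
    sum.\<close>
  define y where "y = (\<lambda>i. SOME z. z \<in> {0..<1} \<and> p z \<in> U i)"
  define J where "J = (\<lambda>i. {y i - l i..y i + l i})"
  have "{0..<1} \<subseteq> (\<Union>i. J i)"
  proof
    fix z :: real assume z: "z \<in> {0..<1}"
    then obtain i where i: "p z \<in> U i" using p U(1) by blast
    then have "y i \<in> {0..<1} \<and> p (y i) \<in> U i"
      unfolding y_def using z by (intro someI[of "\<lambda>z. z \<in> {0..<1} \<and> p z \<in> U i" z]) simp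
    then have "\<bar>z - y i\<bar> \<le> l i" using i z by (intro l) auto
    then have "z \<in> J i" by (auto simp: J_def)
    then show "z \<in> (\<Union>i. J i)" by blast
  qed
  then have "emeasure lborel {0..<1::real} \<le> emeasure lborel (\<Union>i. J i)"
    by (rule emeasure_mono) (auto simp: J_def)
  also have "\<dots> \<le> (\<Sum>i. emeasure lborel (J i))"
    by (rule emeasure_subadditive_countably) (auto simp: J_def)
  also have "\<dots> = (\<Sum>i. ennreal (2 * c) * ennreal (enn2real (sup_diam (U i)) powr t))"
    using \<open>0 < c\<close> by (simp add: J_def l_def mult.assoc flip: ennreal_mult)
  also have "\<dots> = ennreal (2 * c) * (\<Sum>i. ennreal (enn2real (sup_diam (U i)) powr t))"
    by simp
  also have "\<dots> < ennreal (2 * c) * ennreal (1 / (2 * c))"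
    using small \<open>0 < c\<close> by (intro ennreal_mult_strict_left_mono) auto
  also have "\<dots> = 1"
    using \<open>0 < c\<close> by (simp flip: ennreal_mult)
  finally show False by simp
qed

text \<open>The \<open>n\<close>-th cover costs at most \<open>N n * r n powr s\<close> and is
  admissible at scale \<open>\<delta>\<close> once \<open>r n < \<delta>\<close>, so the premeasure
  vanishes at every scale.\<close>

lemma hausdorff_dim_le:
  fixes Y :: "'a::euclidean_space set" and U :: "nat \<Rightarrow> nat \<Rightarrow> 'a set"
  assumes "0 < s"
    and cover: "\<And>n. Y \<subseteq> (\<Union>i<N n. U n i)"
    and diam: "\<And>n i x y. i < N n \<Longrightarrow> x \<in> U n i \<Longrightarrow> y \<in> U n i \<Longrightarrow> infnorm (x - y) \<le> r n"
    and r: "\<And>n. 0 \<le> r n" "r \<longlonglongrightarrow> 0"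
    and sums: "(\<lambda>n. real (N n) * r n powr s) \<longlonglongrightarrow> 0"
  shows "hausdorff_dim Y \<le> ennreal s"
proof -
  have "hausdorff_premeasure s \<delta> Y = 0" if "0 < \<delta>" for \<delta>
  proof -
    have "hausdorff_premeasure s \<delta> Y \<le> ennreal (real (N n) * r n powr s)" if "r n < \<delta>" for n
    proof -
      define V where "V = (\<lambda>i. if i < N n then U n i else {})"
      have V: "sup_diam (V i) \<le> ennreal (if i < N n then r n else 0)" for i
        unfolding sup_diam_def V_def using diam[of i n]
        by (auto intro!: SUP_least ennreal_leI simp: bot_ennreal)
      have "hausdorff_premeasure s \<delta> Y \<le> (\<Sum>i. ennreal (enn2real (sup_diam (V i)) powr s))"
        unfolding hausdorff_premeasure_def
      proof (rule INF_lower, safe)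
        show "x \<in> (\<Union>i. V i)" if "x \<in> Y" for x
          using cover[of n] that by (auto simp: V_def)
        show "sup_diam (V i) \<le> ennreal \<delta>" for i
          using V[of i] \<open>r n < \<delta>\<close> \<open>0 < \<delta>\<close>
          by (elim order_trans) (auto intro!: ennreal_leI)
      qed
      also have "\<dots> \<le> (\<Sum>i. ennreal (if i < N n then r n powr s else 0))"
      proof (intro suminf_le ennreal_leI)
        fix i
        have "enn2real (sup_diam (V i)) \<le> (if i < N n then r n else 0)"
          using V[of i] r(1)[of n] by (intro enn2real_leI) auto
        then show "enn2real (sup_diam (V i)) powr s \<le> (if i < N n then r n powr s else 0)"
          using \<open>0 < s\<close> enn2real_nonneg[of "sup_diam (V i)"]
          by (cases "i < N n") (simp_all add: powr_mono2 order_antisym)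
      qed auto
      also have "\<dots> = (\<Sum>i<N n. ennreal (if i < N n then r n powr s else 0))"
        by (rule suminf_finite) auto
      also have "\<dots> = ennreal (real (N n) * r n powr s)"
        by (simp add: ennreal_mult ennreal_of_nat_eq_real_of_nat)
      finally show ?thesis .
    qed
    then have "\<forall>\<^sub>F n in sequentially. hausdorff_premeasure s \<delta> Y \<le> ennreal (real (N n) * r n powr s)"
      using order_tendstoD(2)[OF r(2) \<open>0 < \<delta>\<close>] by (simp add: eventually_mono)
    moreover have "(\<lambda>n. ennreal (real (N n) * r n powr s)) \<longlonglongrightarrow> ennreal 0"
      using sums by (rule tendsto_ennrealI)
    ultimately have "hausdorff_premeasure s \<delta> Y \<le> ennreal 0"
      using tendsto_lowerbound sequentially_bot by blast
    then show ?thesis by simp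
  qed
  then have "hausdorff_measure s Y = 0"
    unfolding hausdorff_measure_def by (auto simp: SUP_eq_iff)
  then show ?thesis
    unfolding hausdorff_dim_def using \<open>0 < s\<close> by (intro INF_lower) auto
qed

section \<open>A criterion for homogeneity\<close>

lemma hausdorff_distance_approx:
  assumes "hausdorff_distance A K < ennreal e" "k \<in> K"
  obtains a where "a \<in> A" "infnorm (a - k) < e"
proof -
  have "(INF a\<in>A. ennreal (infnorm (a - k))) \<le> hausdorff_distance A K"
    unfolding hausdorff_distance_def using assms(2) by (intro max.coboundedI2 SUP_upper)
  then have "(INF a\<in>A. ennreal (infnorm (a - k))) < ennreal e"
    using assms(1) by simp
  then obtain a where "a \<in> A" "ennreal (infnorm (a - k)) < ennreal e"
    by (auto simp: INF_less_iff)
  then show ?thesis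
    using that by (simp add: ennreal_less_iff infnorm_pos_le)
qed

text \<open>
  Under the rescaling assumption every miniset lies in a homothetic image of ratio at most \<open>1 / q\<close>. These
  ratios and the corresponding translations range over a compact set, so the maps \<open>y \<mapsto> s y + t\<close>
  subconverge along any convergent sequence of minisets; a limit of ratio 0 leaves only a single point.
\<close>

lemma homogeneousI:
  fixes X :: "'a::euclidean_space set"
  assumes "compact X" "X \<noteq> {}" "0 < q" "1 < l"
    and rescale: "\<And>x r. 0 < r \<Longrightarrow> r < q \<Longrightarrow>
      \<exists>x'. unit_cube \<inter> homothety x r ` X \<subseteq> homothety x' (l * r) ` X"
  shows "homogeneous X"
  unfolding homogeneous_def
proof (intro conjI allI impI)
  obtain w where w: "w \<in> X" using assms by blast
  \<comment> \<open>Each use of \<open>rescale\<close> multiplies the radius by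
    \<open>l > 1\<close>, so finitely many bring it to at least \<open>q\<close>. The inclusions
    chain because their left sides stay inside \<open>unit_cube\<close>.\<close>
  have zoom_out: "\<exists>x' r'. q \<le> r' \<and> unit_cube \<inter> homothety x r ` X \<subseteq> homothety x' r' ` X"
    if "0 < r" for x r
  proof -
    obtain n where "q / r < l ^ n" using real_arch_pow[OF \<open>1 < l\<close>] by blast
    then have "q \<le> l ^ n * r" using that by (simp add: field_simps)
    then show ?thesis using that
    proof (induction n arbitrary: x r)
      case (Suc n)
      show ?case
      proof (cases "r < q")
        case True
        then obtain y where y: "unit_cube \<inter> homothety x r ` X \<subseteq> homothety y (l * r) ` X"
          using rescale Suc.prems by blast
        have "0 < l * r" using Suc.prems \<open>1 < l\<close> by simp
        moreover have "q \<le> l ^ n * (l * r)" using Suc.prems by (simp add: mult_ac)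
        ultimately obtain x' r' where "q \<le> r'" "unit_cube \<inter> homothety y (l * r) ` X \<subseteq> homothety x' r' ` X"
          using Suc.IH by blast
        with y show ?thesis by blast
      next
        case False
        then show ?thesis by (intro exI[of _ x] exI[of _ r]) auto
      qed
    qed (intro exI conjI, auto)
  qed
  fix K assume "microset X K"
  then obtain M where K: "K \<subseteq> unit_cube" and M: "\<And>n. miniset X (M n)"
    and lim: "(\<lambda>n. hausdorff_distance (M n) K) \<longlonglongrightarrow> 0"
    unfolding microset_def by blast
  have "\<exists>s t. s \<in> {0..1/q} \<and> M n \<subseteq> (\<lambda>y. s *\<^sub>R y + t) ` X" for n
  proof -
    obtain x r where "0 < r" "M n = unit_cube \<inter> homothety x r ` X"
      using M[of n] unfolding miniset_def by blast
    then obtain x' r' where "q \<le> r'" "M n \<subseteq> homothety x' r' ` X"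
      using zoom_out[of r x] by metis
    moreover have "homothety x' r' = (\<lambda>y. (1 / r') *\<^sub>R y + - ((1 / r') *\<^sub>R x'))"
      by (simp add: homothety_def fun_eq_iff scaleR_diff_right)
    moreover have "1 / r' \<in> {0..1 / q}"
      using \<open>q \<le> r'\<close> \<open>0 < q\<close> by (simp add: frac_le)
    ultimately have "1 / r' \<in> {0..1 / q} \<and> M n \<subseteq> (\<lambda>y. (1 / r') *\<^sub>R y + - ((1 / r') *\<^sub>R x')) ` X"
      by simp
    then show ?thesis by (intro exI)
  qed
  then obtain s t where s: "\<And>n. s n \<in> {0..1/q}"
    and st: "\<And>n. M n \<subseteq> (\<lambda>y. s n *\<^sub>R y + t n) ` X"
    by metis
  have cube: "compact (unit_cube :: 'a set)"
    by (simp add: unit_cube_def)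
  \<comment> \<open>A miniset has a point \<open>m\<close> in the cube, and
    \<open>m = s n *\<^sub>R y + t n\<close> with \<open>y\<close> in \<open>X\<close> determines
    \<open>t n\<close>. Hence the pairs of ratio and translation lie in a continuous image of a
    compact set.\<close>
  define Z where "Z = (\<lambda>(a, m, y). (a, m - a *\<^sub>R y)) ` ({0..1/q} \<times> unit_cube \<times> X)"
  have "compact Z"
    unfolding Z_def split_def
    by (intro compact_continuous_image continuous_intros compact_Times cube assms) auto
  moreover have "(s n, t n) \<in> Z" for n
  proof -
    obtain m where m: "m \<in> M n" "m \<in> unit_cube" using M[of n] by (auto simp: miniset_def)
    then obtain y where "y \<in> X" "m = s n *\<^sub>R y + t n" using st by blast
    with m s[of n] show ?thesis
      unfolding Z_def by (intro image_eqI[of _ _ "(s n, m, y)"]) auto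
  qed
  ultimately obtain c \<sigma> where c: "c \<in> Z" "strict_mono \<sigma>"
    and \<sigma>: "((\<lambda>n. (s n, t n)) \<circ> \<sigma>) \<longlonglongrightarrow> c"
    unfolding compact_def by meson
  obtain a b where [simp]: "c = (a, b)" by fastforce
  have "0 \<le> a" using c(1) by (auto simp: Z_def)
  have a: "(\<lambda>n. s (\<sigma> n)) \<longlonglongrightarrow> a" and b: "(\<lambda>n. t (\<sigma> n)) \<longlonglongrightarrow> b"
    using tendsto_fst[OF \<sigma>] tendsto_snd[OF \<sigma>] by (simp_all add: o_def)
  have K_sub: "K \<subseteq> (\<lambda>y. a *\<^sub>R y + b) ` X"
  proof
    fix k assume "k \<in> K"
    \<comment> \<open>Some point \<open>s (\<sigma> n) *\<^sub>R y + t (\<sigma> n)\<close> of the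
      miniset is near \<open>k\<close>; replacing its coefficients by \<open>a\<close> and
      \<open>b\<close> moves it little, uniformly in \<open>y\<close>, as \<open>X\<close> is
      bounded.\<close>
    have "k \<in> closure ((\<lambda>y. a *\<^sub>R y + b) ` X)"
      unfolding closure_approachable
    proof (intro allI impI)
      fix e :: real assume "0 < e"
      \<comment> \<open>\<open>D\<close> compares the Euclidean norm with the sup-norm that defines
        the Hausdorff distance.\<close>
      define D where "D = sqrt (real DIM('a))"
      have "0 < D" by (simp add: D_def)
      obtain R where R: "\<And>y. y \<in> X \<Longrightarrow> norm y \<le> R"
        using compact_imp_bounded[OF \<open>compact X\<close>] by (auto simp: bounded_iff)
      have "(\<lambda>n. norm (a - s (\<sigma> n)) * R + norm (b - t (\<sigma> n))) \<longlonglongrightarrow> norm (a - a) * R + norm (b - b)"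
        by (intro tendsto_intros a b)
      then have "\<forall>\<^sub>F n in sequentially. norm (a - s (\<sigma> n)) * R + norm (b - t (\<sigma> n)) < e / 2"
        using \<open>0 < e\<close> by (intro order_tendstoD(2)) auto
      moreover have "(\<lambda>n. hausdorff_distance (M (\<sigma> n)) K) \<longlonglongrightarrow> 0"
        using LIMSEQ_subseq_LIMSEQ[OF lim c(2)] by (simp add: o_def)
      then have "\<forall>\<^sub>F n in sequentially. hausdorff_distance (M (\<sigma> n)) K < ennreal (e / (2 * D))"
        using \<open>0 < e\<close> \<open>0 < D\<close> by (intro order_tendstoD(2)) auto
      ultimately have "\<forall>\<^sub>F n in sequentially. norm (a - s (\<sigma> n)) * R + norm (b - t (\<sigma> n)) < e / 2 \<and>
          hausdorff_distance (M (\<sigma> n)) K < ennreal (e / (2 * D))"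
        by (rule eventually_conj)
      then obtain n where n: "norm (a - s (\<sigma> n)) * R + norm (b - t (\<sigma> n)) < e / 2"
        "hausdorff_distance (M (\<sigma> n)) K < ennreal (e / (2 * D))"
        using eventually_happens'[OF sequentially_bot] by blast
      obtain y where y: "y \<in> X" "infnorm (s (\<sigma> n) *\<^sub>R y + t (\<sigma> n) - k) < e / (2 * D)"
        using hausdorff_distance_approx[OF n(2) \<open>k \<in> K\<close>] st[of "\<sigma> n"] by blast
      have "norm (s (\<sigma> n) *\<^sub>R y + t (\<sigma> n) - k) \<le> D * infnorm (s (\<sigma> n) *\<^sub>R y + t (\<sigma> n) - k)"
        unfolding D_def by (rule norm_le_infnorm)
      also have "\<dots> < D * (e / (2 * D))"
        using y(2) \<open>0 < D\<close> by (rule mult_strict_left_mono)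
      also have "\<dots> = e / 2" using \<open>0 < D\<close> by simp
      finally have near: "norm (s (\<sigma> n) *\<^sub>R y + t (\<sigma> n) - k) < e / 2" .
      have "a *\<^sub>R y + b - k =
          ((a - s (\<sigma> n)) *\<^sub>R y + (b - t (\<sigma> n))) + (s (\<sigma> n) *\<^sub>R y + t (\<sigma> n) - k)"
        by (simp add: algebra_simps)
      also have "norm \<dots> \<le> norm (a - s (\<sigma> n)) * norm y + norm (b - t (\<sigma> n))
          + norm (s (\<sigma> n) *\<^sub>R y + t (\<sigma> n) - k)"
        by (intro norm_triangle_le add_right_mono) (simp add: norm_triangle_le)
      also have "\<dots> \<le> norm (a - s (\<sigma> n)) * R + norm (b - t (\<sigma> n))
          + norm (s (\<sigma> n) *\<^sub>R y + t (\<sigma> n) - k)"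
        using R[OF y(1)] by (intro add_right_mono mult_left_mono) auto
      also have "\<dots> < e" using n(1) near by simp
      finally show "\<exists>z\<in>(\<lambda>y. a *\<^sub>R y + b) ` X. dist z k < e"
        using y(1) by (auto simp: dist_norm)
    qed
    moreover have "compact ((\<lambda>y. a *\<^sub>R y + b) ` X)"
      by (intro compact_continuous_image continuous_intros \<open>compact X\<close>)
    ultimately show "k \<in> (\<lambda>y. a *\<^sub>R y + b) ` X"
      using closure_closed compact_imp_closed by blast
  qed
  show "\<exists>M. miniset X M \<and> K \<subseteq> M"
  \<comment> \<open>Here \<open>K\<close> has at most one point, and a translate of \<open>X\<close>
    at radius 1 passes through any given point of the cube. Otherwise the limit map is itself a
    homothety, and \<open>K\<close> being non-empty makes the resulting miniset non-empty.\<close>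
  proof (cases "a = 0 \<or> K = {}")
    case True
    obtain m where m: "m \<in> unit_cube" "K \<subseteq> {m}"
    proof (cases "K = {}")
      case True
      then show ?thesis using that c(1) by (auto simp: Z_def)
    next
      case False
      then show ?thesis using that K_sub K \<open>a = 0 \<or> K = {}\<close> by auto
    qed
    have "m \<in> homothety (w - m) 1 ` X"
      using w by (intro image_eqI[of _ _ w]) (auto simp: homothety_def)
    with m have "miniset X (unit_cube \<inter> homothety (w - m) 1 ` X)"
        "K \<subseteq> unit_cube \<inter> homothety (w - m) 1 ` X"
      unfolding miniset_def using zero_less_one by blast+
    then show ?thesis by blast
  next
    case False
    have eq: "(\<lambda>y. a *\<^sub>R y + b) = homothety (- (1 / a) *\<^sub>R b) (1 / a)"
      using False by (auto simp: homothety_def scaleR_diff_right scaleR_add_right)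
    have "K \<subseteq> unit_cube \<inter> homothety (- (1 / a) *\<^sub>R b) (1 / a) ` X"
      using K_sub K unfolding eq by simp
    moreover from this have "miniset X (unit_cube \<inter> homothety (- (1 / a) *\<^sub>R b) (1 / a) ` X)"
      unfolding miniset_def using False \<open>0 \<le> a\<close>
      by (intro conjI exI[of _ "- (1 / a) *\<^sub>R b"] exI[of _ "1 / a"]) auto
    ultimately show ?thesis by blast
  qed
qed (fact assms)

section \<open>Flat functions and lacunary series\<close>

text \<open>For \<open>m = 0\<close> this is the classical flat function; the powers of
  \<open>1 / t\<close> make the linear span of the family closed under differentiation.\<close>

definition flat :: "nat \<Rightarrow> real \<Rightarrow> real" where
  "flat m t = (if 0 < t then (1 / t) ^ m * exp (- (1 / t)) else 0)"

lemma flat_tendsto_0: "(flat m \<longlongrightarrow> 0) (at 0)"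
proof (rule filterlim_split_at)
  have "eventually (\<lambda>t::real. t \<in> {..<0}) (at_left 0)"
    by (simp add: eventually_at_filter)
  then have "eventually (\<lambda>t. flat m t = 0) (at_left 0)"
    by eventually_elim (simp add: flat_def)
  then show "(flat m \<longlongrightarrow> 0) (at_left 0)"
    by (simp add: tendsto_eventually)
  have "((\<lambda>t::real. inverse t ^ m / exp (inverse t)) \<longlongrightarrow> 0) (at_right 0)"
    by (rule filterlim_compose[OF tendsto_power_div_exp_0 filterlim_inverse_at_top_right])
  moreover have "eventually (\<lambda>t::real. t \<in> {0<..}) (at_right 0)"
    by (simp add: eventually_at_filter)
  then have "eventually (\<lambda>t. inverse t ^ m / exp (inverse t) = flat m t) (at_right 0)"
    by eventually_elim (simp add: flat_def exp_minus inverse_eq_divide)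
  ultimately show "(flat m \<longlongrightarrow> 0) (at_right 0)"
    by (rule Lim_transform_eventually)
qed

lemma flat_has_derivative:
  "(flat m has_real_derivative (flat (m + 2) t - real m * flat (m + 1) t)) (at t)"
proof (cases t "0::real" rule: linorder_cases)
  case less
  have "((\<lambda>t. 0) has_real_derivative 0) (at t)" by simp
  then have "(flat m has_real_derivative 0) (at t)"
    by (rule has_field_derivative_transform_within_open[of _ _ _ "{..<0}"])
       (use less in \<open>auto simp: flat_def\<close>)
  with less show ?thesis by (simp add: flat_def)
next
  case equal
  have "eventually (\<lambda>t::real. t \<noteq> 0) (at 0)"
    by (simp add: eventually_at_filter)
  \<comment> \<open>The difference quotient of \<open>flat m\<close> at 0 is
    \<open>flat (m + 1)\<close>, which tends to 0.\<close>
  then have "eventually (\<lambda>h. flat (m + 1) h = (flat m (0 + h) - flat m 0) / h) (at 0)"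
    by eventually_elim (simp add: flat_def)
  from Lim_transform_eventually[OF flat_tendsto_0 this]
  show ?thesis by (simp add: equal DERIV_def flat_def)
next
  case greater
  have "((\<lambda>t. (1 / t) ^ m * exp (- (1 / t))) has_real_derivative
      (1 / t) ^ (m + 2) * exp (- (1 / t)) - real m * ((1 / t) ^ (m + 1) * exp (- (1 / t)))) (at t)"
  proof (rule DERIV_cong)
    have inv: "((\<lambda>t. 1 / t) has_real_derivative - (1 / t ^ 2)) (at t)"
      using greater by (auto intro!: derivative_eq_intros simp: power2_eq_square)
    show "((\<lambda>t. (1 / t) ^ m * exp (- (1 / t))) has_real_derivative
        real m * (1 / t) ^ (m - 1) * - (1 / t ^ 2) * exp (- (1 / t))
        + (1 / t ^ 2) * exp (- (1 / t)) * (1 / t) ^ m) (at t)"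
      by (rule inv derivative_eq_intros refl)+ simp
    \<comment> \<open>For \<open>m = 0\<close> the truncated exponent \<open>m - 1\<close> does no
      harm, since the factor \<open>real m\<close> vanishes.\<close>
    have "real m * (1 / t) ^ (m - 1) * (1 / t) = real m * (1 / t) ^ m"
      by (cases m) auto
    then have "real m * (1 / t) ^ (m - 1) * (1 / t ^ 2) = real m * (1 / t) ^ (m + 1)"
      by (metis (no_types, lifting) mult.assoc mult.right_neutral power2_eq_square power_add power_one_right power_one_over)
    then show "real m * (1 / t) ^ (m - 1) * - (1 / t ^ 2) * exp (- (1 / t))
        + (1 / t ^ 2) * exp (- (1 / t)) * (1 / t) ^ m =
      (1 / t) ^ (m + 2) * exp (- (1 / t)) - real m * ((1 / t) ^ (m + 1) * exp (- (1 / t)))"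
      by (simp add: algebra_simps power2_eq_square)
  qed
  then have "(flat m has_real_derivative
      (1 / t) ^ (m + 2) * exp (- (1 / t)) - real m * ((1 / t) ^ (m + 1) * exp (- (1 / t)))) (at t)"
    by (rule has_field_derivative_transform_within_open[of _ _ _ "{0<..}"])
       (use greater in \<open>auto simp: flat_def\<close>)
  with greater show ?thesis by (simp add: flat_def)
qed

text \<open>
  Closed under differentiation and consisting of bounded functions, this algebra yields bounds on all
  derivatives of its members without any chain rule of higher order.
\<close>

inductive_set bump_algebra :: "(real \<Rightarrow> real) set" where
  flat: "(\<lambda>x. flat m (- cos (2 * pi * x))) \<in> bump_algebra"
| sin: "(\<lambda>x. sin (2 * pi * x)) \<in> bump_algebra"
| cos: "(\<lambda>x. cos (2 * pi * x)) \<in> bump_algebra"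
| const: "(\<lambda>x. c) \<in> bump_algebra"
| add: "f \<in> bump_algebra \<Longrightarrow> g \<in> bump_algebra \<Longrightarrow> (\<lambda>x. f x + g x) \<in> bump_algebra"
| mult: "f \<in> bump_algebra \<Longrightarrow> g \<in> bump_algebra \<Longrightarrow> (\<lambda>x. f x * g x) \<in> bump_algebra"

lemma bump_algebra_bounded:
  assumes "f \<in> bump_algebra"
  shows "\<exists>B. \<forall>x. \<bar>f x\<bar> \<le> B"
  using assms
proof induction
  case (flat m)
  \<comment> \<open>The argument \<open>- cos (2 * pi * x)\<close> never leaves this compact
    interval.\<close>
  have "continuous_on {-1..1} (flat m)"
    by (meson DERIV_isCont continuous_at_imp_continuous_on flat_has_derivative)
  then have "bounded (flat m ` {-1..1})"
    by (intro compact_imp_bounded compact_continuous_image) auto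
  then obtain B where "\<And>t. t \<in> {-1..1} \<Longrightarrow> \<bar>flat m t\<bar> \<le> B"
    by (fastforce simp: bounded_iff)
  then show ?case by (intro exI[of _ B]) auto
next
  case (add f g)
  then obtain A B where "\<And>x. \<bar>f x\<bar> \<le> A" "\<And>x. \<bar>g x\<bar> \<le> B" by auto
  then have "\<bar>f x + g x\<bar> \<le> A + B" for x
    by (meson abs_triangle_ineq add_mono order_trans)
  then show ?case by blast
next
  case (mult f g)
  then obtain A B where "\<And>x. \<bar>f x\<bar> \<le> A" "\<And>x. \<bar>g x\<bar> \<le> B" by auto
  then have "\<bar>f x * g x\<bar> \<le> A * B" for x
    unfolding abs_mult by (meson abs_ge_zero mult_mono order_trans)
  then show ?case by blast
qed (auto intro: abs_sin_le_one abs_cos_le_one)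

lemma bump_algebra_deriv:
  assumes "f \<in> bump_algebra"
  shows "\<exists>f'\<in>bump_algebra. \<forall>x. (f has_real_derivative f' x) (at x)"
  using assms
proof induction
  case (flat m)
  let ?f' = "\<lambda>x. (flat (m + 2) (- cos (2 * pi * x)) + - real m * flat (m + 1) (- cos (2 * pi * x)))
    * (2 * pi * sin (2 * pi * x))"
  have "((\<lambda>x. flat m (- cos (2 * pi * x))) has_real_derivative ?f' x) (at x)" for x
    by (rule DERIV_chain2[OF flat_has_derivative, THEN DERIV_cong])
       (auto intro!: derivative_eq_intros)
  moreover have "?f' \<in> bump_algebra"
    by (intro bump_algebra.intros)
  ultimately show ?case by (intro bexI[of _ ?f']) auto
next
  case sin
  have "(\<lambda>x. 2 * pi * cos (2 * pi * x)) \<in> bump_algebra"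
    by (intro bump_algebra.intros)
  then show ?case
    by (rule rev_bexI) (auto intro!: derivative_eq_intros)
next
  case cos
  have "(\<lambda>x. - 2 * pi * sin (2 * pi * x)) \<in> bump_algebra"
    by (intro bump_algebra.intros)
  then show ?case
    by (rule rev_bexI) (auto intro!: derivative_eq_intros)
next
  case (const c)
  show ?case
    by (rule bexI[of _ "\<lambda>x. 0"]) (auto intro!: bump_algebra.intros)
next
  case (add f g)
  then obtain f' g' where "f' \<in> bump_algebra" "g' \<in> bump_algebra"
    "\<And>x. (f has_real_derivative f' x) (at x)" "\<And>x. (g has_real_derivative g' x) (at x)"
    by blast
  then show ?case
    by (intro bexI[of _ "\<lambda>x. f' x + g' x"])
       (auto intro: derivative_intros bump_algebra.intros)
next
  case (mult f g)
  then obtain f' g' where *: "f' \<in> bump_algebra" "g' \<in> bump_algebra"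
    "\<And>x. (f has_real_derivative f' x) (at x)" "\<And>x. (g has_real_derivative g' x) (at x)"
    by blast
  then have "((\<lambda>x. f x * g x) has_real_derivative f' x * g x + g' x * f x) (at x)" for x
    by (rule_tac DERIV_mult)
  with * mult.hyps show ?case
    by (intro bexI[of _ "\<lambda>x. f' x * g x + g' x * f x"])
       (auto intro: bump_algebra.intros)
qed

text \<open>Differentiating \<open>k\<close> times costs the factor
  \<open>(4 ^ n) ^ k = (4 ^ k) ^ n\<close>, which the factorial absorbs: an exponential series is a
  majorant uniform in \<open>x\<close>, so termwise differentiation is allowed.\<close>

lemma lacunary_series_deriv:
  fixes b :: "nat \<Rightarrow> real \<Rightarrow> real"
  assumes deriv: "\<And>k x. (b k has_real_derivative b (Suc k) x) (at x)"
    and bounded: "\<And>k. \<exists>B. \<forall>x. \<bar>b k x\<bar> \<le> B"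
  defines "T \<equiv> \<lambda>k n x. (4 ^ n) ^ k * b k (4 ^ n * x) / fact n"
  shows "summable (\<lambda>n. T k n x)"
    and "((\<lambda>x. \<Sum>n. T k n x) has_real_derivative (\<Sum>n. T (Suc k) n x)) (at x)"
proof -
  have major: "\<exists>M. summable M \<and> (\<forall>n x. norm (T k n x) \<le> M n)" for k
  proof -
    obtain B where B: "\<And>x. \<bar>b k x\<bar> \<le> B" using bounded by blast
    have "summable (\<lambda>n. (4 ^ k) ^ n * B / fact n)"
      using summable_mult2[OF summable_exp[of "4 ^ k"], of B] by (simp add: divide_inverse mult_ac)
    moreover have "norm (T k n x) \<le> (4 ^ k) ^ n * B / fact n" for n x
      using B[of "4 ^ n * x"]
      by (simp add: T_def abs_mult divide_right_mono mult.commute flip: power_mult)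
    ultimately show ?thesis by blast
  qed
  show summ: "summable (\<lambda>n. T k n x)" for k x
    using major[of k] summable_comparison_test by metis
  have "uniform_limit UNIV (\<lambda>n x. \<Sum>i<n. T (Suc k) i x) (\<lambda>x. \<Sum>i. T (Suc k) i x) sequentially"
    using major[of "Suc k"] by (metis Weierstrass_m_test)
  moreover have "(T k n has_real_derivative T (Suc k) n x) (at x)" for n x
    unfolding T_def
    by (auto intro!: derivative_eq_intros DERIV_chain2[OF deriv])
  ultimately obtain S where
    "\<And>x. (\<lambda>n. T k n x) sums S x" "\<And>x. (S has_real_derivative (\<Sum>i. T (Suc k) i x)) (at x)"
    using has_field_derivative_series[of UNIV "T k" "T (Suc k)" "\<lambda>x. \<Sum>i. T (Suc k) i x" 0] summ
    by (metis UNIV_I convex_UNIV)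
  moreover from this(1) have "S = (\<lambda>x. \<Sum>n. T k n x)"
    by (auto simp: sums_iff)
  ultimately show "((\<lambda>x. \<Sum>n. T k n x) has_real_derivative (\<Sum>n. T (Suc k) n x)) (at x)"
    by simp
qed

section \<open>The Cantor set\<close>

text \<open>
  The numbers in \<open>[0, 1]\<close> with base-4 digits 0 and 3 only: \<open>cos (2 \<pi> x)\<close> is negative exactly when the
  fractional part of \<open>x\<close> lies in the removed middle half \<open>(1/4, 3/4)\<close>.
\<close>

definition cantor :: "real set" where
  "cantor = {x \<in> {0..1}. \<forall>n. 0 \<le> cos (2 * pi * (4 ^ n * x))}"

text \<open>\<open>H 0\<close> sums the bumps \<open>flat 0 (- cos (2 * pi * (4 ^ n * x)))\<close>,
  each positive exactly where its cosine is negative, with weights \<open>1 / fact n\<close>;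
  \<open>H k\<close> is the \<open>k\<close>-th derivative.\<close>

lemma smooth_pos_off_cantor:
  obtains H :: "nat \<Rightarrow> real \<Rightarrow> real"
  where "\<And>k x. (H k has_real_derivative H (Suc k) x) (at x)"
    and "\<And>x. 0 \<le> H 0 x"
    and "\<And>x n. cos (2 * pi * (4 ^ n * x)) < 0 \<Longrightarrow> 0 < H 0 x"
    and "\<And>x. x \<in> cantor \<Longrightarrow> H 0 x = 0"
proof -
  define b0 where "b0 = (\<lambda>x. flat 0 (- cos (2 * pi * x)))"
  have "\<exists>b. \<forall>k. b k \<in> bump_algebra \<and> (k = 0 \<longrightarrow> b k = b0) \<and>
      (\<forall>x. (b k has_real_derivative b (Suc k) x) (at x))"
    using dependent_nat_choice[of "\<lambda>k f. f \<in> bump_algebra \<and> (k = 0 \<longrightarrow> f = b0)"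
        "\<lambda>k f f'. \<forall>x. (f has_real_derivative f' x) (at x)"]
      bump_algebra_deriv bump_algebra.flat[of 0, folded b0_def]
    by (metis nat.distinct(1))
  then obtain b where b: "\<And>k. b k \<in> bump_algebra" "b 0 = b0"
      "\<And>k x. (b k has_real_derivative b (Suc k) x) (at x)"
    by blast
  define T where "T = (\<lambda>k n x. (4 ^ n) ^ k * b k (4 ^ n * x) / fact n)"
  have summ: "summable (\<lambda>n. T k n x)"
    and deriv: "((\<lambda>x. \<Sum>n. T k n x) has_real_derivative (\<Sum>n. T (Suc k) n x)) (at x)" for k x
    using lacunary_series_deriv[of b k x, OF b(3) bump_algebra_bounded[OF b(1)]]
    unfolding T_def by auto
  have T0: "T 0 n x = flat 0 (- cos (2 * pi * (4 ^ n * x))) / fact n" for n x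
    by (simp add: T_def b(2) b0_def)
  have nonneg: "0 \<le> T 0 n x" for n x
    by (simp add: T0 flat_def)
  show ?thesis
  proof (rule that[of "\<lambda>k x. \<Sum>n. T k n x"])
    show "((\<lambda>x. \<Sum>n. T k n x) has_real_derivative (\<Sum>n. T (Suc k) n x)) (at x)" for k x
      by (rule deriv)
    show "0 \<le> (\<Sum>n. T 0 n x)" for x
      by (intro suminf_nonneg summ nonneg)
    show "0 < (\<Sum>n. T 0 n x)" if "cos (2 * pi * (4 ^ n * x)) < 0" for x n
    proof (rule suminf_pos2[of _ n])
      show "summable (\<lambda>n. T 0 n x)" by (rule summ)
    qed (use that nonneg in \<open>auto simp: T0 flat_def\<close>)
    show "(\<Sum>n. T 0 n x) = 0" if "x \<in> cantor" for x
    proof -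
      have "T 0 n x = 0" for n
        using that by (auto simp: T0 flat_def cantor_def not_less)
      then show ?thesis by simp
    qed
  qed
qed

section \<open>Self-similarity of the Cantor set\<close>

lemma cos_2pi_add_int: "cos (2 * pi * (x + of_int k)) = cos (2 * pi * x)"
proof -
  have "cos (2 * pi * (x + of_int k)) = cos (2 * pi * x + 2 * pi * of_int k)"
    by (simp add: distrib_left)
  also have "\<dots> = cos (2 * pi * x)"
    unfolding cos_add by (simp add: sin_int_2pin cos_int_2pin)
  finally show ?thesis .
qed

lemma cos_2pi_neg:
  assumes "1 / 4 < x" "x < 3 / 4"
  shows "cos (2 * pi * x) < 0"
proof -
  have "pi * (1 / 4) < pi * x" "pi * x < pi * (3 / 4)"
    using assms by (simp_all only: mult_less_cancel_left_pos[OF pi_gt_zero])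
  then have "0 < cos (2 * pi * x - pi)"
    by (intro cos_gt_zero_pi) linarith+
  then show ?thesis by (simp add: cos_diff)
qed

text \<open>The point \<open>(d + w) / 4\<close> lies in one of the outer quarters of
  \<open>[0, 1]\<close>; for \<open>d = 3\<close> a shift by -1 moves it next to 0.\<close>

lemma cos_2pi_nonneg:
  assumes "w \<in> {0..1}" "d = 0 \<or> d = 3"
  shows "0 \<le> cos (2 * pi * ((d + w) / 4))"
proof -
  have w: "0 \<le> pi * w" "pi * w \<le> pi" using assms(1) by auto
  from assms(2) show ?thesis
  proof
    assume "d = 0"
    then have "2 * pi * ((d + w) / 4) = pi * w / 2" by simp
    then show ?thesis using w pi_gt_zero by (intro cos_ge_zero) linarith+
  next
    assume "d = 3"
    have "0 \<le> cos (2 * pi * ((d + w) / 4 + of_int (-1)))"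
      using w \<open>d = 3\<close> by (intro cos_ge_zero) (auto simp: field_simps)
    then show ?thesis by (simp only: cos_2pi_add_int)
  qed
qed

text \<open>The two arguments differ by an integer multiple of \<open>2 * pi\<close>. Thus the
  condition of level \<open>n + 1\<close> on a child is the condition of level \<open>n\<close> on
  its parent.\<close>

lemma cos_2pi_scale:
  assumes "d = 0 \<or> d = 3"
  shows "cos (2 * pi * (4 ^ Suc n * ((d + w) / 4))) = cos (2 * pi * (4 ^ n * w))"
proof -
  obtain k :: int where "d = of_int k"
    using assms by (metis of_int_0 of_int_numeral)
  then have "4 ^ Suc n * ((d + w) / 4) = 4 ^ n * w + of_int (4 ^ n * k)"
    by (simp add: algebra_simps)
  then show ?thesis by (simp only: cos_2pi_add_int)
qed

lemma cantor_child:
  assumes "w \<in> cantor" "d = 0 \<or> d = 3"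
  shows "(d + w) / 4 \<in> cantor"
proof -
  have "0 \<le> cos (2 * pi * (4 ^ n * ((d + w) / 4)))" for n
    using assms cos_2pi_nonneg[of w d] cos_2pi_scale[of d "n - 1" w]
    by (cases n) (auto simp: cantor_def)
  then show ?thesis using assms by (auto simp: cantor_def)
qed

text \<open>The condition of level 0 excludes the open middle half, and the higher levels pass to
  the parent by \<open>cos_2pi_scale\<close>.\<close>

lemma cantor_parent:
  assumes "x \<in> cantor"
  obtains "x \<le> 1 / 4" "4 * x \<in> cantor" | "3 / 4 \<le> x" "4 * x - 3 \<in> cantor"
proof -
  have x: "0 \<le> x" "x \<le> 1" "0 \<le> cos (2 * pi * (4 ^ n * x))" for n
    using assms by (auto simp: cantor_def)
  have tail: "0 \<le> cos (2 * pi * (4 ^ n * (4 * x - d)))" if "d = 0 \<or> d = 3" for n d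
    using cos_2pi_scale[OF that, of n "4 * x - d"] x(3)[of "Suc n"] by simp
  have "x \<le> 1 / 4 \<or> 3 / 4 \<le> x"
    using cos_2pi_neg[of x] x(3)[of 0] by fastforce
  then show ?thesis
    using that x(1,2) tail[of 0] tail[of 3] by (auto simp: cantor_def)
qed

lemma compact_cantor: "compact cantor"
proof -
  have eq: "cantor = {0..1} \<inter> (\<Inter>n. {x. 0 \<le> cos (2 * pi * (4 ^ n * x))})"
    by (auto simp: cantor_def)
  show ?thesis
    unfolding eq
    by (intro compact_Int_closed compact_Icc closed_INT ballI closed_Collect_le continuous_intros)
qed

section \<open>Construction intervals and digit expansions\<close>

lemma zero_in_cantor: "0 \<in> cantor"
  by (simp add: cantor_def)

text \<open>For \<open>i < 2 ^ n\<close>, the left endpoint of the \<open>i\<close>-th construction interval of level \<open>n\<close>.\<close>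

fun cantor_left :: "nat \<Rightarrow> nat \<Rightarrow> real" where
  "cantor_left 0 i = 0"
| "cantor_left (Suc n) i = (3 * real (i mod 2) + cantor_left n (i div 2)) / 4"

text \<open>This supplies, in each construction interval, a point where a function vanishing on
  \<open>cantor\<close> is zero.\<close>

lemma cantor_left_in_cantor: "cantor_left n i \<in> cantor"
proof (induction n arbitrary: i)
  case (Suc n)
  have "3 * real (i mod 2) = 0 \<or> 3 * real (i mod 2) = 3" by (cases "even i") auto
  then show ?case using Suc.IH[of "i div 2"] by (simp add: cantor_child)
qed (simp add: zero_in_cantor)

lemma cantor_cover:
  "x \<in> cantor \<Longrightarrow> \<exists>i<2^n. x \<in> {cantor_left n i..cantor_left n i + 1 / 4 ^ n}"
proof (induction n arbitrary: x)
  case 0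
  then show ?case by (auto simp: cantor_def)
next
  case (Suc n)
  obtain j where j: "j < 2" "4 * x - 3 * real j \<in> cantor"
    using Suc.prems by (cases rule: cantor_parent) (auto intro: that[of 0] that[of 1])
  obtain i where i: "i < 2 ^ n"
      "4 * x - 3 * real j \<in> {cantor_left n i..cantor_left n i + 1 / 4 ^ n}"
    using Suc.IH[OF j(2)] by blast
  \<comment> \<open>The lowest bit of the index encodes the first base-4 digit.\<close>
  have "2 * i + j < 2 ^ Suc n" using i j by auto
  moreover have "(2 * i + j) mod 2 = j" "(2 * i + j) div 2 = i" using j(1) by auto
  then have "x \<in> {cantor_left (Suc n) (2 * i + j)..cantor_left (Suc n) (2 * i + j) + 1 / 4 ^ Suc n}"
    using i(2) by (auto simp: field_simps)
  ultimately show ?case by blast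
qed

text \<open>
  Replaces the binary digits of \<open>y\<close> by base-4 digits 0 and 3: an expanding inverse of the Cantor function.
\<close>

definition base4 :: "real \<Rightarrow> real" where
  "base4 y = (\<Sum>n. 3 * real_of_int (\<lfloor>2 ^ Suc n * y\<rfloor> mod 2) / 4 ^ Suc n)"

lemma base4_summable: "summable (\<lambda>n. 3 * real_of_int (\<lfloor>2 ^ Suc n * y\<rfloor> mod 2) / 4 ^ Suc n)"
  and base4_range: "base4 y \<in> {0..1}"
proof -
  let ?f = "\<lambda>n. 3 * real_of_int (\<lfloor>2 ^ Suc n * y\<rfloor> mod 2) / 4 ^ Suc n"
  have f: "0 \<le> ?f n" "?f n \<le> 3 / 4 * (1 / 4) ^ n" for n
  proof -
    have "0 \<le> \<lfloor>2 ^ Suc n * y\<rfloor> mod 2" "\<lfloor>2 ^ Suc n * y\<rfloor> mod 2 \<le> 1" by auto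
    then show "0 \<le> ?f n" "?f n \<le> 3 / 4 * (1 / 4) ^ n"
      by (simp_all add: power_one_over field_simps)
  qed
  have g: "(\<lambda>n. 3 / 4 * (1 / 4) ^ n) sums (1 :: real)"
    using sums_mult[OF geometric_sums[of "1 / 4 :: real"], of "3 / 4"] by simp
  show summ: "summable ?f"
    using summable_comparison_test'[OF sums_summable[OF g], of 0 ?f] f by auto
  show "base4 y \<in> {0..1}"
    using suminf_le[OF f(2) summ sums_summable[OF g]] suminf_nonneg[OF summ f(1)] sums_unique[OF g]
    by (simp add: base4_def)
qed

lemma base4_rec: "base4 y = (3 * real_of_int (\<lfloor>2 * y\<rfloor> mod 2) + base4 (2 * y)) / 4"
proof -
  have "base4 y = (\<Sum>n. 3 * real_of_int (\<lfloor>2 ^ Suc n * (2 * y)\<rfloor> mod 2) / 4 ^ Suc n / 4)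
      + 3 * real_of_int (\<lfloor>2 * y\<rfloor> mod 2) / 4"
    unfolding base4_def using suminf_split_head[OF base4_summable[of y]] by (simp add: mult_ac)
  also have "(\<Sum>n. 3 * real_of_int (\<lfloor>2 ^ Suc n * (2 * y)\<rfloor> mod 2) / 4 ^ Suc n / 4) = base4 (2 * y) / 4"
    unfolding base4_def by (rule suminf_divide[OF base4_summable])
  finally show ?thesis by (simp add: add_divide_distrib)
qed

lemma base4_add_int: "base4 (y + of_int k) = base4 y"
proof -
  have "\<lfloor>2 ^ Suc n * (y + of_int k)\<rfloor> mod 2 = \<lfloor>2 ^ Suc n * y\<rfloor> mod 2" for n
  proof -
    \<comment> \<open>The added integer is even, so the parity of the floor is unchanged.\<close>
    have "2 ^ Suc n * (y + of_int k) = 2 ^ Suc n * y + of_int (2 * (2 ^ n * k))"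
      by (simp add: algebra_simps)
    then show ?thesis by (simp only: floor_add_int[symmetric]) simp
  qed
  then show ?thesis by (simp add: base4_def)
qed

text \<open>By \<open>base4_rec\<close>, \<open>base4 y\<close> is a child of
  \<open>base4 (2 * y)\<close>; the induction is on the level \<open>n\<close>, for all
  \<open>y\<close> at once.\<close>

lemma base4_in_cantor: "base4 y \<in> cantor"
proof -
  have "0 \<le> cos (2 * pi * (4 ^ n * base4 y))" for n
  proof (induction n arbitrary: y)
    case 0
    have "3 * real_of_int (\<lfloor>2 * y\<rfloor> mod 2) = 0 \<or> 3 * real_of_int (\<lfloor>2 * y\<rfloor> mod 2) = 3"
      by (cases "even \<lfloor>2 * y\<rfloor>") auto
    with cos_2pi_nonneg[OF base4_range] show ?case
      by (subst base4_rec) simp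
  next
    case (Suc n)
    have "3 * real_of_int (\<lfloor>2 * y\<rfloor> mod 2) = 0 \<or> 3 * real_of_int (\<lfloor>2 * y\<rfloor> mod 2) = 3"
      by (cases "even \<lfloor>2 * y\<rfloor>") auto
    from cos_2pi_scale[OF this] Suc show ?case
      by (subst base4_rec) simp
  qed
  with base4_range show ?thesis by (simp add: cantor_def)
qed

text \<open>If the first binary digits differ, the images lie in different halves, at distance at
  least 1/2. If they agree, removing them doubles \<open>y - z\<close> and quadruples the difference
  of the images.\<close>

lemma base4_separated:
  assumes "y \<in> {0..<1}" "z \<in> {0..<1}" "1 / 2 ^ n < \<bar>y - z\<bar>"
  shows "2 / 4 ^ n \<le> \<bar>base4 y - base4 z\<bar>"
  using assms
proof (induction n arbitrary: y z)
  case (Suc n)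
  \<comment> \<open>Passing from \<open>2 * x\<close> to its fractional part stays in
    \<open>{0..<1}\<close> and leaves \<open>base4\<close> unchanged.\<close>
  have digit: "\<lfloor>2 * x\<rfloor> \<in> {0, 1}" "2 * x - of_int \<lfloor>2 * x\<rfloor> \<in> {0..<1}"
    "4 * base4 x = 3 * real_of_int \<lfloor>2 * x\<rfloor> + base4 (2 * x - of_int \<lfloor>2 * x\<rfloor>)"
    if "x \<in> {0..<1}" for x :: real
  proof -
    show d: "\<lfloor>2 * x\<rfloor> \<in> {0, 1}" using that by (auto simp: floor_eq_iff)
    show "2 * x - of_int \<lfloor>2 * x\<rfloor> \<in> {0..<1}" by (simp; linarith)
    have "\<lfloor>2 * x\<rfloor> mod 2 = \<lfloor>2 * x\<rfloor>" using d by auto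
    then show "4 * base4 x = 3 * real_of_int \<lfloor>2 * x\<rfloor> + base4 (2 * x - of_int \<lfloor>2 * x\<rfloor>)"
      using base4_rec[of x] base4_add_int[of "2 * x" "- \<lfloor>2 * x\<rfloor>"] by simp
  qed
  define y' z' where "y' = 2 * y - of_int \<lfloor>2 * y\<rfloor>" and "z' = 2 * z - of_int \<lfloor>2 * z\<rfloor>"
  note dy = digit[OF Suc.prems(1), folded y'_def] and dz = digit[OF Suc.prems(2), folded z'_def]
  show ?case
  proof (cases "\<lfloor>2 * y\<rfloor> = \<lfloor>2 * z\<rfloor>")
    case True
    then have "y' - z' = 2 * (y - z)" by (simp add: y'_def z'_def)
    then have "1 / 2 ^ n < \<bar>y' - z'\<bar>" using Suc.prems(3) by (simp add: abs_mult)
    then have "2 / 4 ^ n \<le> \<bar>base4 y' - base4 z'\<bar>" by (intro Suc.IH dy dz)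
    also have "base4 y' - base4 z' = 4 * (base4 y - base4 z)"
      using dy(3) dz(3) True by simp
    finally show ?thesis by (simp add: abs_mult)
  next
    case False
    then have "2 \<le> \<bar>4 * base4 y - 4 * base4 z\<bar>"
      using dy(1,3) dz(1,3) base4_range[of y'] base4_range[of z'] by auto
    moreover have "2 / 4 ^ Suc n \<le> (1 / 2 :: real)"
      using one_le_power[of "4::real" n] by (simp add: field_simps)
    ultimately show ?thesis by linarith
  qed
qed auto

text \<open>Apply \<open>base4_separated\<close> at the least \<open>n\<close> with
  \<open>1 / 2 ^ n < \<bar>y - z\<bar>\<close>; minimality bounds \<open>\<bar>y - z\<bar>\<close>
  by twice that scale.\<close>

lemma base4_expanding:
  assumes "y \<in> {0..<1}" "z \<in> {0..<1}"
  shows "\<bar>y - z\<bar> \<le> 2 * \<bar>base4 y - base4 z\<bar> powr (1 / 2)"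
proof (cases "y = z")
  case False
  define n where "n = (LEAST n. 1 / 2 ^ n < \<bar>y - z\<bar>)"
  have "\<exists>n. 1 / 2 ^ n < \<bar>y - z\<bar>"
    using real_arch_pow_inv[of "\<bar>y - z\<bar>" "1 / 2"] False by (simp add: power_one_over)
  then have n: "1 / 2 ^ n < \<bar>y - z\<bar>"
    unfolding n_def by (rule LeastI_ex)
  with assms obtain m where m: "n = Suc m" by (cases n) auto
  have "\<not> 1 / 2 ^ m < \<bar>y - z\<bar>"
    using not_less_Least[of m "\<lambda>n. 1 / 2 ^ n < \<bar>y - z\<bar>"] m n_def by simp
  then have "\<bar>y - z\<bar> \<le> 1 / 2 ^ m" by simp
  then have "\<bar>y - z\<bar> ^ 2 \<le> (1 / 2 ^ m) ^ 2"
    by (intro power_mono) auto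
  also have "\<dots> = 1 / 4 ^ m"
    by (simp add: power_one_over power2_eq_square flip: power_mult_distrib)
  \<comment> \<open>The generous factor 4 has the exact square root 2.\<close>
  also have "\<dots> \<le> 4 * \<bar>base4 y - base4 z\<bar>"
  proof -
    have "1 / 4 ^ m = 2 * (2 / 4 ^ n :: real)" using m by simp
    also have "\<dots> \<le> 4 * \<bar>base4 y - base4 z\<bar>"
      using base4_separated[OF assms n] by (intro mult_mono) auto
    finally show ?thesis .
  qed
  finally have "\<bar>y - z\<bar> \<le> sqrt (4 * \<bar>base4 y - base4 z\<bar>)"
    by (rule real_le_rsqrt)
  then show ?thesis by (simp add: real_sqrt_mult powr_half_sqrt)
qed simp

section \<open>Dimension and homogeneity of the embedded Cantor set\<close>

lemma hausdorff_dim_cantor: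
  "ennreal (1 / 2) \<le> hausdorff_dim (axis i ` cantor :: (real ^ 'n) set)"
proof (rule hausdorff_dim_ge)
  show "(\<lambda>y. axis i (base4 y)) ` {0..<1} \<subseteq> axis i ` cantor"
    using base4_in_cantor by auto
  fix y z :: real assume yz: "y \<in> {0..<1}" "z \<in> {0..<1}"
  have "\<bar>base4 y - base4 z\<bar> \<le> infnorm (axis i (base4 y) - axis i (base4 z) :: real ^ 'n)"
    using component_le_infnorm_cart[of "axis i (base4 y) - axis i (base4 z)" i] by simp
  then have "\<bar>base4 y - base4 z\<bar> powr (1 / 2)
      \<le> infnorm (axis i (base4 y) - axis i (base4 z) :: real ^ 'n) powr (1 / 2)"
    by (intro powr_mono2) auto
  then show "\<bar>y - z\<bar> \<le> 2 * infnorm (axis i (base4 y) - axis i (base4 z) :: real ^ 'n) powr (1 / 2)"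
    using base4_expanding[OF yz] by linarith
qed simp

lemma homogeneous_cantor: "homogeneous (axis i ` cantor :: (real ^ 'n) set)"
proof (rule homogeneousI[of _ "1 / 4" 4])
  show "compact (axis i ` cantor :: (real ^ 'n) set)"
  proof (rule compact_continuous_image)
    have eq: "axis i = (\<lambda>x. x *\<^sub>R axis i 1 :: real ^ 'n)"
      by (auto simp: axis_def vec_eq_iff)
    show "continuous_on cantor (axis i :: real \<Rightarrow> real ^ 'n)"
      by (subst eq) (intro continuous_intros)
  qed (rule compact_cantor)
  fix x :: "real ^ 'n" and r :: real
  assume r: "0 < r" "r < 1 / 4"
  \<comment> \<open>Points of the left half within \<open>r < 1 / 4\<close> of the centre force
    \<open>x $ i < 1 / 2\<close>, those of the right half \<open>x $ i > 1 / 2\<close>. So the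
    centre alone decides which digit to remove.\<close>
  define d :: real where "d = (if x $ i \<le> 1 / 2 then 0 else 3)"
  have "homothety x r (axis i u) \<in> homothety (4 *\<^sub>R x - axis i d) (4 * r) ` axis i ` cantor"
    if "u \<in> cantor" "homothety x r (axis i u) \<in> unit_cube" for u
  proof -
    have "\<bar>homothety x r (axis i u) $ i\<bar> \<le> 1"
    proof -
      define e :: "real ^ 'n" where "e = axis i 1"
      have "e \<in> Basis" by (simp add: e_def axis_in_Basis_iff)
      then have "- One \<bullet> e \<le> homothety x r (axis i u) \<bullet> e" "homothety x r (axis i u) \<bullet> e \<le> One \<bullet> e"
        using that(2) unfolding unit_cube_def mem_box by blast+
      then show ?thesis using \<open>e \<in> Basis\<close>
        by (simp add: abs_le_iff) (simp add: e_def inner_axis)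
    qed
    then have "\<bar>u - x $ i\<bar> \<le> r"
      using r by (simp add: homothety_def abs_mult field_simps)
    from that(1) have "4 * u - d \<in> cantor"
    proof (cases rule: cantor_parent)
      case 1
      then have "x $ i \<le> 1 / 2" using \<open>\<bar>u - x $ i\<bar> \<le> r\<close> r by linarith
      then show ?thesis using 1 by (simp add: d_def)
    next
      case 2
      then have "\<not> x $ i \<le> 1 / 2" using \<open>\<bar>u - x $ i\<bar> \<le> r\<close> r by linarith
      then show ?thesis using 2 by (simp add: d_def)
    qed
    \<comment> \<open>Point, centre and radius are all transformed by the same expansion of ratio 4,
      so the normalised position is unchanged.\<close>
    moreover have "homothety x r (axis i u)
        = homothety (4 *\<^sub>R x - axis i d) (4 * r) (axis i (4 * u - d))"
      using r by (auto simp: homothety_def vec_eq_iff axis_def field_simps)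
    ultimately show ?thesis by blast
  qed
  then show "\<exists>x'. unit_cube \<inter> homothety x r ` axis i ` cantor
      \<subseteq> homothety x' (4 * r) ` axis i ` cantor"
    by (intro exI[of _ "4 *\<^sub>R x - axis i d"]) auto
qed (use zero_in_cantor in auto)

section \<open>Smoothness, small image and injectivity\<close>

text \<open>The factor \<open>c\<close> and the index \<open>m\<close> make the form stable: the
  derivative in direction \<open>w\<close> has \<open>c * w $ i\<close> and \<open>Suc m\<close> in
  their place.\<close>

lemma C_diff_component:
  fixes G :: "nat \<Rightarrow> real \<Rightarrow> real"
  assumes "\<And>k x. (G k has_real_derivative G (Suc k) x) (at x)"
  shows "C_diff k (\<lambda>v :: real ^ 'n. c * G m (v $ i))"
proof (induction k arbitrary: c m)
  case 0
  have "continuous_on UNIV (G m)"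
    using DERIV_isCont[OF assms] by (simp add: continuous_at_imp_continuous_on)
  then have "continuous_on UNIV (\<lambda>v :: real ^ 'n. G m (v $ i))"
    by (rule continuous_on_compose2) (auto intro: continuous_intros)
  then show ?case
    by (auto intro: continuous_intros)
next
  case (Suc k)
  have D: "((\<lambda>v :: real ^ 'n. c * G m (v $ i)) has_derivative (\<lambda>w. c * w $ i * G (Suc m) (v $ i))) (at v)"
    for v
  proof -
    have "(G m has_derivative (\<lambda>t. G (Suc m) (v $ i) * t)) (at (v $ i))"
      using assms by (simp add: has_field_derivative_def)
    from has_derivative_compose[where f = "\<lambda>v. v $ i", OF bounded_linear.has_derivative[OF bounded_linear_vec_nth has_derivative_ident] this]
    have "((\<lambda>v. G m (v $ i)) has_derivative (\<lambda>w. G (Suc m) (v $ i) * w $ i)) (at v)" .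
    from has_derivative_mult_right[OF this, of c] show ?thesis
      by (simp add: mult_ac)
  qed
  then have "frechet_derivative (\<lambda>v :: real ^ 'n. c * G m (v $ i)) (at v)
      = (\<lambda>w. c * w $ i * G (Suc m) (v $ i))" for v
    using frechet_derivative_at by metis
  then show ?case
    using D Suc.IH by (auto simp: differentiable_def)
qed

text \<open>On an interval of level \<open>n\<close>, \<open>h\<close> vanishes at the left endpoint
  and is Lipschitz, hence at most \<open>L / 4 ^ n\<close>; so \<open>g\<close> varies by at most
  \<open>L / 16 ^ n\<close> there.\<close>

lemma hausdorff_dim_flat_image:
  fixes g h h' :: "real \<Rightarrow> real"
  assumes g: "\<And>x. (g has_real_derivative h x) (at x)"
    and h: "\<And>x. (h has_real_derivative h' x) (at x)"
    and "continuous_on {0..1} h'"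
    and zero: "\<And>x. x \<in> cantor \<Longrightarrow> h x = 0"
  shows "hausdorff_dim (g ` cantor) \<le> ennreal (3 / 8)"
proof -
  have "bounded (h' ` {0..1})"
    using assms(3) by (intro compact_imp_bounded compact_continuous_image) auto
  then obtain L where L: "\<And>x. x \<in> {0..1} \<Longrightarrow> norm (h' x) \<le> L"
    unfolding bounded_iff by blast
  have "0 \<le> L" using L[of 0] by (meson atLeastAtMost_iff norm_ge_zero order_trans order_refl zero_le_one)
  \<comment> \<open>The intersection keeps \<open>I n i\<close> where \<open>L\<close> bounds
    \<open>h'\<close>.\<close>
  define I where "I = (\<lambda>n i. {cantor_left n i..cantor_left n i + 1 / 4 ^ n} \<inter> {0..1})"
  show ?thesis
  proof (rule hausdorff_dim_le[where U = "\<lambda>n i. g ` I n i" and N = "\<lambda>n. 2 ^ n" and r = "\<lambda>n. L / 16 ^ n"])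
    show "g ` cantor \<subseteq> (\<Union>i<2 ^ n. g ` I n i)" for n
    proof
      fix y assume "y \<in> g ` cantor"
      then obtain x where "x \<in> cantor" "y = g x" by blast
      with cantor_cover[OF this(1), of n] show "y \<in> (\<Union>i<2 ^ n. g ` I n i)"
        by (force simp: I_def cantor_def)
    qed
    fix n i x y assume "x \<in> g ` I n i" "y \<in> g ` I n i"
    then obtain u v where uv: "u \<in> I n i" "v \<in> I n i" and xy: "x = g u" "y = g v" by blast
    have "cantor_left n i \<in> {0..1}"
      using cantor_left_in_cantor[of n i] by (simp add: cantor_def)
    have "norm (h w) \<le> L / 4 ^ n" if "w \<in> I n i" for w
    proof -
      have "norm (h w - h (cantor_left n i)) \<le> L * norm (w - cantor_left n i)"
        by (rule field_differentiable_bound[of "{0..1}" h h'])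
           (use that \<open>cantor_left n i \<in> {0..1}\<close> in
             \<open>simp_all add: I_def L[simplified] has_field_derivative_at_within[OF h]\<close>)
      also have "\<dots> \<le> L * (1 / 4 ^ n)"
        using that \<open>0 \<le> L\<close> by (intro mult_left_mono) (auto simp: I_def)
      finally show ?thesis using zero[OF cantor_left_in_cantor] by simp
    qed
    moreover have "convex (I n i)" by (simp add: I_def convex_Int)
    ultimately have "norm (g u - g v) \<le> L / 4 ^ n * norm (u - v)"
      using uv by (intro field_differentiable_bound[of "I n i" g h] has_field_derivative_at_within[OF g])
    also have "\<dots> \<le> L / 4 ^ n * (1 / 4 ^ n)"
      using uv \<open>0 \<le> L\<close> by (intro mult_left_mono) (auto simp: I_def)
    also have "\<dots> = L / 16 ^ n"
      by (simp flip: power_mult_distrib)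
    finally show "infnorm (x - y) \<le> L / 16 ^ n"
      using infnorm_le_norm[of "g u - g v"] unfolding xy by (rule order_trans[rotated])
  next
    have "(\<lambda>n. L * (1 / 16) ^ n) \<longlonglongrightarrow> L * 0"
      by (intro tendsto_intros LIMSEQ_realpow_zero) auto
    then show "(\<lambda>n. L / 16 ^ n) \<longlonglongrightarrow> 0"
      by (simp add: power_one_over)
    \<comment> \<open>\<open>q\<close> is the ratio of the geometric cost sequence; it is below 1
      because \<open>3 / 8\<close> exceeds \<open>1 / 4\<close>, where
      \<open>16 powr (1 / 4) = 2\<close>.\<close>
    define q :: real where "q = 2 / 16 powr (3 / 8)"
    have "(2::real) = (2 powr 4) powr (1 / 4)" by (simp only: powr_powr) simp
    also have "\<dots> = 16 powr (1 / 4)" by simp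
    also have "\<dots> < 16 powr (3 / 8 :: real)" by (intro powr_less_mono) auto
    finally have "q < 1" by (simp add: q_def)
    moreover have "0 \<le> q" by (simp add: q_def)
    ultimately have "(\<lambda>n. L powr (3 / 8) * q ^ n) \<longlonglongrightarrow> L powr (3 / 8) * 0"
      by (intro tendsto_intros LIMSEQ_realpow_zero)
    moreover have "real (2 ^ n) * (L / 16 ^ n) powr (3 / 8) = L powr (3 / 8) * q ^ n" for n
    proof -
      have "(16 ^ n :: real) powr (3 / 8) = (16 powr (3 / 8)) ^ n"
        by (simp add: powr_powr mult.commute flip: powr_realpow)
      then show ?thesis
        using \<open>0 \<le> L\<close> by (simp add: q_def powr_divide power_divide)
    qed
    ultimately show "(\<lambda>n. real (2 ^ n) * (L / 16 ^ n) powr (3 / 8)) \<longlonglongrightarrow> 0"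
      by simp
  qed (use \<open>0 \<le> L\<close> in auto)
qed

text \<open>Stretched to length above 2, the interval contains a half-integer
  \<open>1 / 2 + of_int k\<close>, where the cosine is -1.\<close>

lemma cos_neg_dense:
  fixes x y :: real
  assumes "x < y"
  obtains z n where "x < z" "z < y" "cos (2 * pi * (4 ^ n * z)) < 0"
proof -
  obtain n where "2 / (y - x) < 4 ^ n"
    using real_arch_pow[of 4 "2 / (y - x)"] by auto
  then have n: "2 < 4 ^ n * y - 4 ^ n * x"
    using assms by (simp add: field_simps)
  define k where "k = \<lfloor>4 ^ n * x\<rfloor> + 1"
  define z :: real where "z = (1 / 2 + of_int k) / 4 ^ n"
  have z: "4 ^ n * z = 1 / 2 + of_int k" by (simp add: z_def)
  have "4 ^ n * x < 4 ^ n * z" "4 ^ n * z < 4 ^ n * y"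
    unfolding z k_def using n by linarith+
  moreover have "cos (2 * pi * (4 ^ n * z)) < 0"
    unfolding z cos_2pi_add_int by simp
  ultimately show ?thesis using that by simp
qed

theorem proposition1p34:
  shows "\<exists>(X :: (real^2) set) (f :: real^2 \<Rightarrow> real).
    homogeneous X \<and> smooth f \<and> inj_on f X \<and>
    (\<forall>y\<in>f ` X. is_singleton (X \<inter> f -` {y})) \<and>
    hausdorff_dim (f ` X) < hausdorff_dim X"
proof -
  obtain H :: "nat \<Rightarrow> real \<Rightarrow> real"
    where H: "\<And>k x. (H k has_real_derivative H (Suc k) x) (at x)"
      and nonneg: "\<And>x. 0 \<le> H 0 x"
      and pos: "\<And>x n. cos (2 * pi * (4 ^ n * x)) < 0 \<Longrightarrow> 0 < H 0 x"
      and zero: "\<And>x. x \<in> cantor \<Longrightarrow> H 0 x = 0"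
    using smooth_pos_off_cantor by blast
  have cont: "isCont (H k) x" for k x by (rule DERIV_isCont[OF H])
  obtain g where g: "\<And>x. (g has_real_derivative H 0 x) (at x)"
    using einterval_antiderivative[of "-\<infinity>" \<infinity> "H 0"] cont
    by (auto simp: has_real_derivative_iff_has_vector_derivative)
  have "inj g"
  proof (rule linorder_injI)
    fix x y :: real assume "x < y"
    obtain z n where z: "x < z" "z < y" "cos (2 * pi * (4 ^ n * z)) < 0"
      using cos_neg_dense[OF \<open>x < y\<close>] .
    have mono: "g a \<le> g b" if "a \<le> b" for a b
      using DERIV_nonneg_imp_nondecreasing[OF that] g nonneg by blast
    show "g x \<noteq> g y"
    proof
      assume "g x = g y"
      \<comment> \<open>Equal end values make the monotone \<open>g\<close> constant in between,
        against its positive derivative at \<open>z\<close>.\<close>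
      then have const: "g w = g x" if "w \<in> {x<..<y}" for w
        using mono[of x w] mono[of w y] that by auto
      have "((\<lambda>_. g x) has_real_derivative H 0 z) (at z)"
        by (rule has_field_derivative_transform_within_open[OF g, where S = "{x<..<y}"])
           (use z const in auto)
      then have "H 0 z = 0" by (metis DERIV_const DERIV_unique)
      with pos[OF z(3)] show False by simp
    qed
  qed
  define X :: "(real^2) set" where "X = axis 1 ` cantor"
  define f :: "real^2 \<Rightarrow> real" where "f = (\<lambda>v. g (v $ 1))"
  have "smooth f"
    unfolding smooth_def
  proof
    fix k
    \<comment> \<open>Prepending \<open>g\<close> to \<open>H\<close> gives the full sequence of
      derivatives of \<open>g\<close>.\<close>
    have "((case_nat g H) m has_real_derivative (case_nat g H) (Suc m) x) (at x)" for m x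
      using g H by (cases m) auto
    from C_diff_component[of "case_nat g H", OF this, of k 1 0 1] show "C_diff k f"
      by (simp add: f_def)
  qed
  \<comment> \<open>On the axis carrying \<open>X\<close> the first coordinate determines the
    point.\<close>
  have inj: "inj_on f X"
    using \<open>inj g\<close> by (auto simp: inj_on_def f_def X_def)
  have "is_singleton (X \<inter> f -` {y})" if "y \<in> f ` X" for y
  proof -
    from that obtain x where "x \<in> X" "y = f x" by blast
    with inj have "X \<inter> f -` {y} = {x}" by (auto dest: inj_onD)
    then show ?thesis by simp
  qed
  moreover have "hausdorff_dim (f ` X) < hausdorff_dim X"
  proof -
    have "f ` X = g ` cantor" by (simp add: X_def f_def image_image)
    also have "hausdorff_dim \<dots> \<le> ennreal (3 / 8)"
      using hausdorff_dim_flat_image[OF g H] zero cont by (simp add: continuous_at_imp_continuous_on)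
    also have "\<dots> < ennreal (1 / 2)" by (rule ennreal_lessI) auto
    also have "\<dots> \<le> hausdorff_dim X" unfolding X_def by (rule hausdorff_dim_cantor)
    finally show ?thesis .
  qed
  moreover have "homogeneous X" unfolding X_def by (rule homogeneous_cantor)
  ultimately show ?thesis using \<open>smooth f\<close> inj by blast
qed

end
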